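(* Let $X$ be a separable infinite-dimensional complex Banach space. There exists an $\mathcal{AP}$-recurrent continuous linear operator $T$ on $X$ such that $\Sigma(T\oplus T)=\emptyset$ and, for every $g\in\Sigma(T)$, the set $\mathrm{R}(T,g)$ is not dense-lineable.
   Context: For a Banach space $Y$ (here $Y=X$ or $Y=X\times X$) and a continuous linear operator $S$ on $Y$, and a continuous linear operator $g$ on $Y$, $\mathrm{R}(S,g)$ is the set of $y\in Y$ for which there is a strictly increasing sequence of positive integers $(\omega_n)_n$ with $\lim_n S^{\omega_n}y=g(y)$; and $\Sigma(S)$ is the set of all continuous linear operators $g$ on $Y$ such that $\mathrm{R}(S,g)$ is dense in $Y$. $T\oplus T$ acts on $X\times X$ coordinatewise. $\mathcal{AP}$ is the family of subsets of $\mathbb{N}\cup\{0\}$ containing arbitrarily long finite arithmetic progressions (with positive common difference). A point $x\in X$ is $\mathcal{AP}$-recurrent for $T$ if for every neighbourhood $U$ of $x$ the set $\{n\in\mathbb{N}\cup\{0\}:T^nx\in U\}$ belongs to $\mathcal{AP}$; $T$ is $\mathcal{AP}$-recurrent if the set of $\mathcal{AP}$-recurrent points is dense in $X$. A subset $A\subset X$ is dense-lineable if $A\cup\{0\}$ contains a dense linear subspace of $X$. *)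

theory Defs
  imports "HOL-Analysis.Analysis"
begin

section \<open>Complex Banach spaces\<close>

class scaleC =
  fixes scaleC :: "complex \<Rightarrow> 'a \<Rightarrow> 'a" (infixr "*\<^sub>C" 75)

text \<open>The underlying real structure (and hence the topology) is the one already provided by
  \<^class>\<open>real_normed_vector\<close>; \<open>scaleR_scaleC\<close> ties the two scalar multiplications together.\<close>

class complex_normed_vector = real_normed_vector + scaleC +
  assumes scaleC_add_right: "a *\<^sub>C (x + y) = a *\<^sub>C x + a *\<^sub>C y"
    and scaleC_add_left: "(a + b) *\<^sub>C x = a *\<^sub>C x + b *\<^sub>C x"
    and scaleC_scaleC: "a *\<^sub>C b *\<^sub>C x = (a * b) *\<^sub>C x"
    and scaleR_scaleC: "scaleR r x = complex_of_real r *\<^sub>C x"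
    and norm_scaleC: "norm (a *\<^sub>C x) = cmod a * norm x"

class complex_banach = complex_normed_vector + banach

lemma scaleC_one: "1 *\<^sub>C x = (x :: 'a :: complex_normed_vector)"
  using scaleR_scaleC[of 1 x] by simp

global_interpretation complex_vector: vector_space "scaleC :: complex \<Rightarrow> 'a \<Rightarrow> 'a :: complex_normed_vector"
  defines csubspace = complex_vector.subspace
    and cspan = complex_vector.span
  by unfold_locales
    (simp_all add: scaleC_add_right scaleC_add_left scaleC_scaleC scaleC_one)

instantiation complex :: complex_banach
begin

definition scaleC_complex :: "complex \<Rightarrow> complex \<Rightarrow> complex"
  where "scaleC_complex = (*)"

instance
  by standard (simp_all add: scaleC_complex_def algebra_simps scaleR_conv_of_real norm_mult)

end

text \<open>The library norm on the product is the Euclidean combination of the two norms; it induces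
  the product topology.\<close>

instantiation prod :: (complex_normed_vector, complex_normed_vector) complex_normed_vector
begin

definition scaleC_prod :: "complex \<Rightarrow> 'a \<times> 'b \<Rightarrow> 'a \<times> 'b"
  where "scaleC_prod a v = (a *\<^sub>C fst v, a *\<^sub>C snd v)"

instance
proof
  fix a b :: complex and x y :: "'a \<times> 'b" and r :: real
  show "a *\<^sub>C (x + y) = a *\<^sub>C x + a *\<^sub>C y"
    by (simp add: scaleC_prod_def scaleC_add_right)
  show "(a + b) *\<^sub>C x = a *\<^sub>C x + b *\<^sub>C x"
    by (simp add: scaleC_prod_def scaleC_add_left)
  show "a *\<^sub>C b *\<^sub>C x = (a * b) *\<^sub>C x"
    by (simp add: scaleC_prod_def scaleC_scaleC)
  show "scaleR r x = complex_of_real r *\<^sub>C x"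
    by (simp add: scaleC_prod_def scaleR_prod_def scaleR_scaleC)
  have "norm (a *\<^sub>C x) = sqrt ((cmod a)\<^sup>2 * ((norm (fst x))\<^sup>2 + (norm (snd x))\<^sup>2))"
    by (simp add: scaleC_prod_def norm_prod_def norm_scaleC power_mult_distrib distrib_left)
  then show "norm (a *\<^sub>C x) = cmod a * norm x"
    by (simp add: norm_prod_def real_sqrt_mult)
qed

end

instance prod :: (complex_banach, complex_banach) complex_banach ..

definition continuous_clinear ::
  "('a :: complex_normed_vector \<Rightarrow> 'b :: complex_normed_vector) \<Rightarrow> bool"
  where "continuous_clinear S \<longleftrightarrow> Vector_Spaces.linear scaleC scaleC S \<and> continuous_on UNIV S"


section \<open>Recurrence notions\<close>

definition recurrence_set ::
  "('a :: complex_banach \<Rightarrow> 'a) \<Rightarrow> ('a \<Rightarrow> 'a) \<Rightarrow> 'a set"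
  where "recurrence_set S g =
    {y. \<exists>\<omega> :: nat \<Rightarrow> nat. strict_mono \<omega> \<and> (\<forall>n. \<omega> n > 0) \<and> (\<lambda>n. (S ^^ \<omega> n) y) \<longlonglongrightarrow> g y}"

definition Sigma_op :: "('a :: complex_banach \<Rightarrow> 'a) \<Rightarrow> ('a \<Rightarrow> 'a) set"
  where "Sigma_op S = {g. continuous_clinear g \<and> closure (recurrence_set S g) = UNIV}"

definition AP :: "nat set set"
  where "AP = {A. \<forall>k. \<exists>a d. d > 0 \<and> (\<forall>i<k. a + i * d \<in> A)}"

definition AP_recurrent_point :: "('a :: complex_banach \<Rightarrow> 'a) \<Rightarrow> 'a \<Rightarrow> bool"
  where "AP_recurrent_point T x \<longleftrightarrow>
    (\<forall>U. open U \<and> x \<in> U \<longrightarrow> {n. (T ^^ n) x \<in> U} \<in> AP)"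

definition AP_recurrent :: "('a :: complex_banach \<Rightarrow> 'a) \<Rightarrow> bool"
  where "AP_recurrent T \<longleftrightarrow> closure {x. AP_recurrent_point T x} = UNIV"

definition dense_lineable :: "'a :: complex_banach set \<Rightarrow> bool"
  where "dense_lineable A \<longleftrightarrow> (\<exists>V. csubspace V \<and> closure V = UNIV \<and> V \<subseteq> A \<union> {0})"

end

theory Submission
  imports Defs
begin

text \<open>
  Take a biorthogonal sequence \<open>(v\<^sub>n, v\<^sub>n*)\<close> whose \<open>v\<^sub>n\<close> span a dense subspace, and
  write \<open>e\<^sub>k = v\<^sub>k\<^sub>+\<^sub>2\<close>. The operator is
  \<open>T x = x + \<Sum>k. (l\<^sub>k - 1) f\<^sub>k(x) e\<^sub>k\<close>, where \<open>l\<^sub>k = exp (2 \<pi> i / m\<^sub>k)\<close> for a very fast growing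
  divisibility chain \<open>m\<^sub>0 | m\<^sub>1 | \<dots>\<close>, and
  \<open>f\<^sub>k = v\<^sub>k\<^sub>+\<^sub>2* + b\<^sub>k w\<^sub>k\<close> with \<open>w\<^sub>k = v\<^sub>1* - q\<^sub>k v\<^sub>0*\<close>. Here \<open>q\<close> runs through a dense subset of
  the complex plane, taking each of its values infinitely often, and \<open>b\<^sub>k\<close> exceeds
  \<open>m\<^sub>k / m\<^sub>k\<^sub>-\<^sub>1\<close> by a factor whose quotient by one plus the norm of \<open>v\<^sub>k\<^sub>+\<^sub>2*\<close> tends to
  infinity. Since
  \<open>f\<^sub>i(e\<^sub>j) = \<delta>\<^sub>i\<^sub>j\<close>, the powers are \<open>T\<^sup>n x = x + \<Sum>k. (l\<^sub>k\<^sup>n - 1) f\<^sub>k(x) e\<^sub>k\<close>.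

  Recurrence: if \<open>x\<close> is a finite combination of the \<open>v\<^sub>n\<close> and \<open>w\<^sub>k\<^sub>+\<^sub>1(x) = 0\<close>, then for large \<open>k\<close> and
  \<open>n = i m\<^sub>k\<close>, with \<open>i\<close> below a fixed bound \<open>L\<close>, the summands up to \<open>k\<close> vanish because \<open>l\<^sub>j\<^sup>n = 1\<close>, the summand \<open>k + 1\<close> vanishes because
  \<open>f\<^sub>k\<^sub>+\<^sub>1(x) = 0\<close>, and the remaining ones are tiny. So the multiples \<open>0, m\<^sub>k, 2 m\<^sub>k, \<dots>, (L - 1) m\<^sub>k\<close>
  are return times. Such \<open>x\<close>, with \<open>w\<^sub>k(x) = 0\<close> for infinitely many \<open>k\<close>, are dense
  (\<open>AP_recurrent_T\<close>).

  Escape: for \<open>m\<^sub>k / 2 \<le> n < m\<^sub>k\<^sub>+\<^sub>1 / 2\<close> the coordinate of \<open>T\<^sup>n x\<close> along \<open>e\<^sub>k\<^sub>+\<^sub>1\<close> is so large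
  that the norm of \<open>T\<^sup>n x\<close> is at least \<open>(k + 1) |w\<^sub>k\<^sub>+\<^sub>1(x)|\<close> up to a multiple of the norm of \<open>x\<close>
  (\<open>norm_power_ge\<close>), and these intervals cover the positive integers. Hence the orbit of
  \<open>x\<close> tends to infinity in norm as soon as \<open>|w\<^sub>k(x)|\<close> is bounded away from \<open>0\<close>. The minor
  \<open>v\<^sub>0*(x) v\<^sub>1*(y) - v\<^sub>0*(y) v\<^sub>1*(x)\<close> equals \<open>v\<^sub>0*(x) w\<^sub>k(y) - v\<^sub>0*(y) w\<^sub>k(x)\<close> for every \<open>k\<close>. When it is
  nonzero, which happens on a nonempty open set of pairs, the orbits of \<open>x\<close> and \<open>y\<close> cannot be bounded
  along a common sequence of times, so \<open>\<Sigma>(T \<oplus> T)\<close> is empty (\<open>Sigma_op_sum_empty\<close>). Moreover a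
  dense subspace contains such \<open>x\<close> and \<open>y\<close>, hence also \<open>z = v\<^sub>0*(x) y - v\<^sub>0*(y) x\<close>, for which
  \<open>w\<^sub>k(z)\<close> is this nonzero constant; the orbit of \<open>z\<close> tends to infinity in norm, so \<open>z\<close> lies in no
  \<open>R(T, g)\<close> (\<open>not_dense_lineable_recurrence_set\<close>).

  The functionals \<open>v\<^sub>n*\<close> come from the Hahn--Banach theorem and a Gram--Schmidt type recursion.
\<close>

section \<open>Hahn--Banach via minimal sublinear functionals\<close>

text \<open>Subadditive and positively homogeneous functionals. One inequality is enough in the homogeneity
  clause: applying it to \<open>1 / t\<close> gives the other.\<close>

definition sublinear :: "('a::real_vector \<Rightarrow> real) \<Rightarrow> bool" where
  "sublinear p \<longleftrightarrow> (\<forall>x y. p (x + y) \<le> p x + p y) \<and> (\<forall>t>0. \<forall>x. p (t *\<^sub>R x) \<le> t * p x)"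

lemma sublinear_add: "sublinear p \<Longrightarrow> p (x + y) \<le> p x + p y"
  by (simp add: sublinear_def)

lemma sublinear_scale_pos:
  assumes "sublinear p" "t > 0"
  shows "p (t *\<^sub>R x) = t * p x"
proof (rule antisym)
  show "p (t *\<^sub>R x) \<le> t * p x" using assms by (simp add: sublinear_def)
  have "p (inverse t *\<^sub>R (t *\<^sub>R x)) \<le> inverse t * p (t *\<^sub>R x)"
    using assms unfolding sublinear_def by (meson positive_imp_inverse_positive)
  then show "t * p x \<le> p (t *\<^sub>R x)" using assms(2) by (simp add: field_simps)
qed

lemma sublinear_zero: "sublinear p \<Longrightarrow> p 0 = 0"
  using sublinear_scale_pos[of p 2 0] by simp

lemma sublinear_scale: "sublinear p \<Longrightarrow> t \<ge> 0 \<Longrightarrow> p (t *\<^sub>R x) = t * p x"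
  using sublinear_scale_pos[of p t x] sublinear_zero[of p] by (cases "t = 0") auto

lemma sublinear_lower: "sublinear p \<Longrightarrow> - p (- x) \<le> p x"
  using sublinear_add[of p x "-x"] sublinear_zero[of p] by simp

text \<open>The standard reduction of a sublinear \<open>p\<close> in the direction \<open>y\<close>: a sublinear functional below \<open>p\<close> whose
  value at \<open>- y\<close> is at most \<open>- p y\<close>. It drives both the linearity of minimal sublinear functionals
  and the choice of a functional that is nonzero at a given point.\<close>

definition directional_inf :: "('a::real_vector \<Rightarrow> real) \<Rightarrow> 'a \<Rightarrow> 'a \<Rightarrow> real" where
  "directional_inf p y x = (INF t\<in>{0..}. p (x + t *\<^sub>R y) - t * p y)"

lemma directional_inf_le:
  assumes "sublinear p" "t \<ge> 0"
  shows "directional_inf p y x \<le> p (x + t *\<^sub>R y) - t * p y"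
  unfolding directional_inf_def
proof (rule cINF_lower)
  show "bdd_below ((\<lambda>t. p (x + t *\<^sub>R y) - t * p y) ` {0..})"
  proof (rule bdd_belowI2)
    fix t :: real assume "t \<in> {0..}"
    then show "- p (- x) \<le> p (x + t *\<^sub>R y) - t * p y"
      using sublinear_add[OF assms(1), of "x + t *\<^sub>R y" "-x"] sublinear_scale[OF assms(1), of t y]
      by simp
  qed
qed (use assms in simp)

lemma directional_inf_le_self: "sublinear p \<Longrightarrow> directional_inf p y x \<le> p x"
  using directional_inf_le[of p 0 y x] by simp

lemma sublinear_directional_inf:
  assumes p: "sublinear p"
  shows "sublinear (directional_inf p y)"
  unfolding sublinear_def
proof safe
  fix a b :: 'a
  let ?q = "directional_inf p y"
  have key: "?q (a + b) \<le> (p (a + s *\<^sub>R y) - s * p y) + (p (b + t *\<^sub>R y) - t * p y)"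
    if "s \<ge> 0" "t \<ge> 0" for s t
    using directional_inf_le[OF p, of "s + t" y "a + b"] that
      sublinear_add[OF p, of "a + s *\<^sub>R y" "b + t *\<^sub>R y"]
    by (simp add: algebra_simps)
  have "?q (a + b) - (p (a + s *\<^sub>R y) - s * p y) \<le> ?q b" if "s \<ge> 0" for s
    unfolding directional_inf_def[of p y b]
  proof (rule cINF_greatest)
    show "?q (a + b) - (p (a + s *\<^sub>R y) - s * p y) \<le> p (b + t *\<^sub>R y) - t * p y"
      if "t \<in> {0..}" for t using key[of s t] that \<open>s \<ge> 0\<close> by simp
  qed simp
  then have "?q (a + b) - ?q b \<le> ?q a"
    unfolding directional_inf_def[of p y a]
    by (intro cINF_greatest) (auto simp: algebra_simps)
  then show "?q (a + b) \<le> ?q a + ?q b" by simp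
next
  fix c :: real and a :: 'a assume c: "0 < c"
  let ?q = "directional_inf p y"
  have "?q (c *\<^sub>R a) / c \<le> p (a + t *\<^sub>R y) - t * p y" if "t \<ge> 0" for t
  proof -
    have "?q (c *\<^sub>R a) \<le> p (c *\<^sub>R a + (c * t) *\<^sub>R y) - (c * t) * p y"
      using directional_inf_le[OF p, of "c * t" y "c *\<^sub>R a"] c that by simp
    also have "p (c *\<^sub>R a + (c * t) *\<^sub>R y) = c * p (a + t *\<^sub>R y)"
      using sublinear_scale_pos[OF p c, of "a + t *\<^sub>R y"] by (simp add: scaleR_add_right)
    finally show ?thesis using c by (simp add: field_simps)
  qed
  then have "?q (c *\<^sub>R a) / c \<le> ?q a"
    unfolding directional_inf_def[of p y a] by (intro cINF_greatest) auto
  then show "?q (c *\<^sub>R a) \<le> c * ?q a" using c by (simp add: field_simps)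
qed

text \<open>The values of the members at \<open>x\<close> are bounded below by \<open>- p (- x)\<close>, so the pointwise
  infimum of a chain is finite; the chain property gives its subadditivity.\<close>

lemma sublinear_chain_inf:
  assumes "C \<noteq> {}" and sub: "\<forall>f\<in>C. sublinear f \<and> f \<le> p"
    and chain: "\<forall>f\<in>C. \<forall>g\<in>C. f \<le> g \<or> g \<le> f"
  defines "u \<equiv> \<lambda>x. INF f\<in>C. f x"
  shows "sublinear u" "\<And>f. f \<in> C \<Longrightarrow> u \<le> f"
proof -
  have bdd: "bdd_below ((\<lambda>f. f x) ` C)" for x
  proof (rule bdd_belowI2)
    fix f assume "f \<in> C"
    with sub sublinear_lower[of f x] show "- p (- x) \<le> f x"
      by (auto simp: le_fun_def intro: order_trans[rotated])
  qed
  have le: "u x \<le> f x" if "f \<in> C" for f x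
    unfolding u_def by (rule cINF_lower[OF bdd that])
  then show "\<And>f. f \<in> C \<Longrightarrow> u \<le> f" by (simp add: le_fun_def)
  show "sublinear u" unfolding sublinear_def
  proof safe
    fix a b :: 'a
    have key: "u (a + b) \<le> f a + g b" if fg: "f \<in> C" "g \<in> C" for f g
    proof -
      obtain h where "h \<in> C" "h \<le> f" "h \<le> g" using chain fg by blast
      then show ?thesis
        using le[of h "a + b"] sub sublinear_add[of h a b]
          le_funD[of h f a] le_funD[of h g b] by fastforce
    qed
    have "u (a + b) - f a \<le> u b" if "f \<in> C" for f
      unfolding u_def[of] using key[OF that, unfolded u_def] assms(1)
      by (intro cINF_greatest) (auto simp: algebra_simps)
    then have "u (a + b) - u b \<le> f a" if "f \<in> C" for f using that by (simp add: algebra_simps)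
    then have "u (a + b) - u b \<le> u a"
      using assms(1) unfolding u_def by (intro cINF_greatest) auto
    then show "u (a + b) \<le> u a + u b" by simp
  next
    fix c :: real and a :: 'a assume c: "0 < c"
    have "u (c *\<^sub>R a) / c \<le> f a" if "f \<in> C" for f
      using le[OF that, of "c *\<^sub>R a"] sublinear_scale_pos[of f c a] sub that c
      by (simp add: field_simps)
    then have "u (c *\<^sub>R a) / c \<le> u a"
      using assms(1) unfolding u_def by (intro cINF_greatest) auto
    then show "u (c *\<^sub>R a) \<le> c * u a" using c by (simp add: field_simps)
  qed
qed

text \<open>By minimality every \<open>directional_inf p y\<close> equals \<open>p\<close>, which yields superadditivity.\<close>

theorem minimal_sublinear_is_linear:
  assumes p: "sublinear p" and min: "\<And>q. sublinear q \<Longrightarrow> q \<le> p \<Longrightarrow> q = p"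
  shows "linear p"
proof -
  have eq: "directional_inf p y = p" for y
    by (rule min) (auto simp: p sublinear_directional_inf le_fun_def directional_inf_le_self)
  have add: "p (x + y) = p x + p y" for x y
    using directional_inf_le[OF p, of 1 y x] sublinear_add[OF p, of x y] by (simp add: eq)
  have neg: "p (- x) = - p x" for x
    using add[of x "-x"] sublinear_zero[OF p] by simp
  show ?thesis
  proof (rule linearI[OF add])
    show "p (r *\<^sub>R b) = r *\<^sub>R p b" for r b
    proof (cases "r \<ge> 0")
      case False
      then show ?thesis using sublinear_scale[OF p, of "-r" b] neg[of "r *\<^sub>R b"] by simp
    qed (simp add: sublinear_scale[OF p])
  qed
qed

theorem hahn_banach_sublinear:
  fixes p :: "'a::real_vector \<Rightarrow> real"
  assumes p: "sublinear p"
  obtains f where "linear f" "f \<le> p"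
proof -
  let ?A = "{f. sublinear f \<and> f \<le> p}"
  let ?P = "\<lambda>f g :: 'a \<Rightarrow> real. g \<le> f"
  have "\<exists>m\<in>?A. \<forall>a\<in>?A. ?P m a \<longrightarrow> a = m"
  proof (rule predicate_Zorn)
    show "partial_order_on ?A (relation_of ?P ?A)"
      by (rule partial_order_on_relation_ofI) auto
    fix C assume C: "C \<in> Chains (relation_of ?P ?A)"
    show "\<exists>u\<in>?A. \<forall>a\<in>C. ?P a u"
    proof (cases "C = {}")
      case False
      have sub: "\<forall>f\<in>C. sublinear f \<and> f \<le> p"
        and chain: "\<forall>f\<in>C. \<forall>g\<in>C. f \<le> g \<or> g \<le> f"
        using C unfolding Chains_def relation_of_def by blast+
      note inf = sublinear_chain_inf[OF False sub chain]
      from False obtain f where "f \<in> C" by blast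
      have "(\<lambda>x. INF f\<in>C. f x) \<in> ?A"
        using inf(1) inf(2)[OF \<open>f \<in> C\<close>] sub \<open>f \<in> C\<close> by (blast intro: order_trans)
      moreover have "\<forall>a\<in>C. ?P a (\<lambda>x. INF f\<in>C. f x)" using inf(2) by blast
      ultimately show ?thesis by blast
    qed (use p in auto)
  qed
  then obtain m where m: "sublinear m" "m \<le> p"
    and min: "\<And>a. sublinear a \<Longrightarrow> a \<le> p \<Longrightarrow> a \<le> m \<Longrightarrow> a = m" by blast
  have "linear m"
    by (rule minimal_sublinear_is_linear[OF m(1)]) (use min m(2) in \<open>auto intro: order_trans\<close>)
  with m(2) that show ?thesis by blast
qed

section \<open>Continuous complex-linear functionals\<close>

text \<open>Complex linearity is expressed through the real notion \<^const>\<open>bounded_linear\<close> together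
  with complex homogeneity, so that \<^const>\<open>onorm\<close> and the calculus of bounded linear maps apply.\<close>

definition cfunctional :: "('a::complex_normed_vector \<Rightarrow> complex) \<Rightarrow> bool" where
  "cfunctional f \<longleftrightarrow> bounded_linear f \<and> (\<forall>c x. f (c *\<^sub>C x) = c * f x)"

lemma cfunctional_scale: "cfunctional f \<Longrightarrow> f (c *\<^sub>C x) = c * f x"
  by (simp add: cfunctional_def)

lemma cfunctional_bounded_linear: "cfunctional f \<Longrightarrow> bounded_linear f"
  by (simp add: cfunctional_def)

lemma cfunctional_add: "cfunctional f \<Longrightarrow> f (x + y) = f x + f y"
  by (simp add: cfunctional_def linear_add bounded_linear.linear)

lemma cfunctional_diff: "cfunctional f \<Longrightarrow> f (x - y) = f x - f y"
  by (simp add: cfunctional_def linear_diff bounded_linear.linear)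

lemma cfunctional_sum: "cfunctional f \<Longrightarrow> f (\<Sum>i\<in>I. g i) = (\<Sum>i\<in>I. f (g i))"
  by (simp add: cfunctional_def linear_sum bounded_linear.linear)

lemma cfunctional_onorm: "cfunctional f \<Longrightarrow> cmod (f x) \<le> onorm f * norm x"
  by (simp add: cfunctional_def onorm)

lemma cfunctional_plus: "cfunctional f \<Longrightarrow> cfunctional g \<Longrightarrow> cfunctional (\<lambda>x. f x + g x)"
  by (simp add: cfunctional_def bounded_linear_add algebra_simps)

lemma cfunctional_minus: "cfunctional f \<Longrightarrow> cfunctional g \<Longrightarrow> cfunctional (\<lambda>x. f x - g x)"
  by (simp add: cfunctional_def bounded_linear_sub algebra_simps)

lemma cfunctional_times: "cfunctional f \<Longrightarrow> cfunctional (\<lambda>x. c * f x)"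
  by (simp add: cfunctional_def bounded_linear_const_mult)

lemma cfunctional_sums: "(\<And>i. i \<in> I \<Longrightarrow> cfunctional (f i)) \<Longrightarrow> cfunctional (\<lambda>x. \<Sum>i\<in>I. f i x)"
  by (simp add: cfunctional_def bounded_linear_sum sum_distrib_left)

lemma bounded_linear_scaleC_right: "bounded_linear (\<lambda>x :: 'a::complex_normed_vector. c *\<^sub>C x)"
  by (rule bounded_linear_intro[of _ "cmod c"])
    (simp_all add: scaleC_add_right scaleR_scaleC scaleC_scaleC norm_scaleC mult.commute)

lemma cfunctional_separates:
  fixes x0 :: "'a::complex_normed_vector"
  assumes "x0 \<noteq> 0"
  obtains \<phi> where "cfunctional \<phi>" "\<phi> x0 = 1"
proof -
  have n: "sublinear (norm :: 'a \<Rightarrow> real)"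
    by (simp add: sublinear_def norm_triangle_ineq)
  \<comment> \<open>Starting below the infimum in direction \<open>x0\<close> forces \<open>f (- x0) \<le> - norm x0\<close>.\<close>
  obtain f where f: "linear f" "f \<le> directional_inf norm x0"
    using hahn_banach_sublinear[OF sublinear_directional_inf[OF n]] .
  have f_le: "f x \<le> norm x" for x
    using f(2) directional_inf_le_self[OF n, of x0 x] by (auto simp: le_fun_def intro: order_trans)
  have "f (- x0) \<le> - norm x0"
    using f(2)[THEN le_funD, of "- x0"] directional_inf_le[OF n, of 1 x0 "- x0"] by simp
  then have fx0: "f x0 > 0" using assms linear_neg[OF f(1), of x0] zero_less_norm_iff[of x0]
    by linarith
  have abs_f: "\<bar>f x\<bar> \<le> norm x" for x
    using f_le[of x] f_le[of "-x"] linear_neg[OF f(1), of x] by simp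
  define \<psi> where "\<psi> x = complex_of_real (f x) - \<i> * complex_of_real (f (\<i> *\<^sub>C x))" for x
  have f_add: "f (x + y) = f x + f y" for x y by (rule linear_add[OF f(1)])
  have f_R: "f (complex_of_real r *\<^sub>C x) = r * f x" for r x
    using linear_cmul[OF f(1), of r x] by (simp add: scaleR_scaleC)
  have psi_add: "\<psi> (x + y) = \<psi> x + \<psi> y" for x y
    by (simp add: \<psi>_def f_add scaleC_add_right algebra_simps)
  have psi_R: "\<psi> (complex_of_real r *\<^sub>C x) = complex_of_real r * \<psi> x" for r x
  proof -
    have "\<i> *\<^sub>C complex_of_real r *\<^sub>C x = complex_of_real r *\<^sub>C \<i> *\<^sub>C x"
      by (simp add: scaleC_scaleC mult.commute)
    then have "f (\<i> *\<^sub>C complex_of_real r *\<^sub>C x) = r * f (\<i> *\<^sub>C x)" by (simp only: f_R)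
    then show ?thesis unfolding \<psi>_def by (simp only: f_R) (simp add: algebra_simps)
  qed
  have psi_i: "\<psi> (\<i> *\<^sub>C x) = \<i> * \<psi> x" for x
  proof -
    have "\<i> *\<^sub>C \<i> *\<^sub>C x = complex_of_real (-1) *\<^sub>C x" by (simp add: scaleC_scaleC)
    then have "f (\<i> *\<^sub>C \<i> *\<^sub>C x) = - f x" by (simp only: f_R)
    then show ?thesis by (simp add: \<psi>_def algebra_simps)
  qed
  have psi_C: "\<psi> (c *\<^sub>C x) = c * \<psi> x" for c x
  proof -
    have "c *\<^sub>C x = complex_of_real (Re c) *\<^sub>C x + \<i> *\<^sub>C complex_of_real (Im c) *\<^sub>C x"
      by (simp add: scaleC_scaleC flip: scaleC_add_left complex_eq)
    then have "\<psi> (c *\<^sub>C x) = (complex_of_real (Re c) + \<i> * complex_of_real (Im c)) * \<psi> x"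
      by (simp only: psi_add psi_R psi_i distrib_right mult.assoc)
    then show ?thesis by (simp flip: complex_eq)
  qed
  have "cmod (\<psi> x) \<le> norm x * 2" for x
  proof -
    have "cmod (\<psi> x) \<le> \<bar>f x\<bar> + \<bar>f (\<i> *\<^sub>C x)\<bar>"
      unfolding \<psi>_def by (rule order_trans[OF norm_triangle_ineq4]) (simp add: norm_mult)
    also have "\<dots> \<le> norm x + norm x"
      using abs_f[of x] abs_f[of "\<i> *\<^sub>C x"] by (simp add: norm_scaleC)
    finally show ?thesis by simp
  qed
  moreover have "\<psi> (r *\<^sub>R x) = r *\<^sub>R \<psi> x" for r x
    by (simp only: scaleR_scaleC[where x = x] psi_R scaleR_conv_of_real)
  ultimately have "bounded_linear \<psi>"
    by (intro bounded_linear_intro[of _ 2]) (simp_all add: psi_add)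
  then have "cfunctional \<psi>" by (simp add: cfunctional_def psi_C)
  moreover have "Re (\<psi> x0) = f x0" by (simp add: \<psi>_def)
  then have "\<psi> x0 \<noteq> 0" using fx0 by auto
  ultimately show thesis
    by (intro that[of "\<lambda>x. inverse (\<psi> x0) * \<psi> x"]) (simp_all add: cfunctional_times)
qed

section \<open>A biorthogonal sequence with dense span\<close>

text \<open>At step \<open>n\<close> project \<open>d n\<close> (or, if \<open>d n\<close> is already in the span, any vector outside it) into
  the common kernel of the previous functionals, and correct a functional separating the result from
  \<open>0\<close> so that it vanishes on the previous vectors. The span then contains every \<open>d n\<close>.\<close>

lemma exists_biorthogonal_sequence:
  fixes d :: "nat \<Rightarrow> 'a::complex_normed_vector"
  assumes infinite_dim: "\<not> (\<exists>B :: 'a set. finite B \<and> cspan B = UNIV)"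
  obtains v :: "nat \<Rightarrow> 'a" and vs :: "nat \<Rightarrow> 'a \<Rightarrow> complex"
  where "\<And>n. cfunctional (vs n)" "\<And>i j. vs i (v j) = (if i = j then 1 else 0)"
    "\<And>n. d n \<in> cspan (v ` {..n})"
proof -
  define P where "P = (\<lambda>(F :: nat \<Rightarrow> 'a \<times> ('a \<Rightarrow> complex)) n (r :: 'a \<times> ('a \<Rightarrow> complex)).
    cfunctional (snd r) \<and> snd r (fst r) = 1 \<and>
    (\<forall>i<n. snd r (fst (F i)) = 0 \<and> snd (F i) (fst r) = 0) \<and>
    d n \<in> cspan (insert (fst r) ((\<lambda>i. fst (F i)) ` {..<n})))"
  \<comment> \<open>\<open>P F n r\<close>: the pair \<open>r\<close> of a vector and a functional extends the system \<open>F\<close> at position \<open>n\<close>.\<close>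
  have "\<exists>F. \<forall>n. P F n (F n)"
  proof (rule dependent_wellorder_choice)
    show "P f x r = P g x r" if "\<And>y. y < x \<Longrightarrow> f y = g y" for r f g and x :: nat
    proof -
      have "(\<lambda>i. fst (f i)) ` {..<x} = (\<lambda>i. fst (g i)) ` {..<x}" using that by auto
      then show ?thesis unfolding P_def using that by auto
    qed
    fix n F assume IH: "\<And>m. m < n \<Longrightarrow> P F m (F m)"
    define v where "v i = fst (F i)" for i
    define vs where "vs i = snd (F i)" for i
    have vs: "cfunctional (vs i)" if "i < n" for i using IH[OF that] by (simp add: P_def vs_def)
    have bi: "vs i (v j) = (if i = j then 1 else 0)" if "i < n" "j < n" for i j
      using IH[OF that(1)] IH[OF that(2)] unfolding P_def v_def vs_def
      by (cases i j rule: linorder_cases) auto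
    let ?S = "cspan (v ` {..<n})"
    have "?S \<noteq> UNIV" using infinite_dim by blast
    then obtain x where x: "x \<notin> ?S" "d n \<in> ?S \<or> x = d n" by (cases "d n \<in> ?S") auto
    define s where "s = (\<Sum>i<n. vs i x *\<^sub>C v i)"
    have s: "s \<in> ?S" unfolding s_def
      by (intro complex_vector.span_sum complex_vector.span_scale complex_vector.span_base) auto
    define e where "e = x - s"
    have "e \<noteq> 0" using x(1) s by (auto simp: e_def)
    have e0: "vs j e = 0" if "j < n" for j
    proof -
      have "vs j s = (\<Sum>i<n. if i = j then vs j x else 0)"
        unfolding s_def cfunctional_sum[OF vs[OF that]]
        by (intro sum.cong) (auto simp: cfunctional_scale[OF vs] that bi)
      then show ?thesis using that by (simp add: e_def cfunctional_diff[OF vs[OF that]])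
    qed
    obtain \<phi>0 where phi0: "cfunctional \<phi>0" "\<phi>0 e = 1"
      using cfunctional_separates[OF \<open>e \<noteq> 0\<close>] .
    define \<phi> where "\<phi> y = \<phi>0 y - (\<Sum>i<n. \<phi>0 (v i) * vs i y)" for y
    have "cfunctional \<phi>" unfolding \<phi>_def
      by (intro cfunctional_minus phi0 cfunctional_sums cfunctional_times vs) auto
    moreover have "\<phi> e = 1" using e0 by (simp add: \<phi>_def phi0)
    moreover have "\<phi> (v j) = 0" if "j < n" for j
    proof -
      have "(\<Sum>i<n. \<phi>0 (v i) * vs i (v j)) = (\<Sum>i<n. if i = j then \<phi>0 (v j) else 0)"
        by (intro sum.cong) (auto simp: bi that)
      then show ?thesis using that by (simp add: \<phi>_def)
    qed
    moreover have "d n \<in> cspan (insert e (v ` {..<n}))" (is "_ \<in> ?S'")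
    proof -
      have sub: "?S \<subseteq> ?S'" by (rule complex_vector.span_mono) auto
      have "e + s \<in> ?S'"
        using s sub by (intro complex_vector.span_add) (auto intro: complex_vector.span_base)
      then show ?thesis using x(2) sub by (auto simp: e_def)
    qed
    ultimately have "P F n (e, \<phi>)" using e0 by (simp add: P_def v_def vs_def)
    then show "\<exists>r. P F n r" ..
  qed
  then obtain F where F: "\<And>n. P F n (F n)" by blast
  show thesis
  proof (rule that[of "\<lambda>n. snd (F n)" "\<lambda>n. fst (F n)"])
    show "cfunctional (snd (F n))" for n using F[of n] by (simp add: P_def)
    show "snd (F i) (fst (F j)) = (if i = j then 1 else 0)" for i j
      using F[of i] F[of j] unfolding P_def by (cases i j rule: linorder_cases) auto
    have "insert (fst (F n)) ((\<lambda>i. fst (F i)) ` {..<n}) = (\<lambda>i. fst (F i)) ` {..n}" for n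
      by (auto simp: less_le)
    then show "d n \<in> cspan ((\<lambda>i. fst (F i)) ` {..n})" for n
      using F[of n] by (simp add: P_def)
  qed
qed

section \<open>Diagonal perturbations of the identity\<close>

text \<open>The operator \<open>I + \<Sum>k. (l k - 1) (f k \<otimes> e k)\<close> for a biorthogonal system \<open>(e, f)\<close>: it fixes the
  common kernel of the \<open>f k\<close> and multiplies \<open>e k\<close> by the unimodular number \<open>l k\<close>.\<close>

locale diagonal_perturbation =
  fixes e :: "nat \<Rightarrow> 'a::complex_banach" and f :: "nat \<Rightarrow> 'a \<Rightarrow> complex" and l :: "nat \<Rightarrow> complex"
  assumes functional_f: "cfunctional (f k)"
    and biorthogonal: "f i (e j) = (if i = j then 1 else 0)"
    and unimodular: "cmod (l k) = 1"
    and summable_weights: "summable (\<lambda>k. cmod (l k - 1) * onorm (f k) * norm (e k))"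
begin

definition T :: "'a \<Rightarrow> 'a" where
  "T x = x + (\<Sum>k. ((l k - 1) * f k x) *\<^sub>C e k)"

lemma term_bound:
  "norm (((l k ^ n - 1) * f k x) *\<^sub>C e k)
    \<le> real n * norm x * (cmod (l k - 1) * onorm (f k) * norm (e k))"
proof -
  have "cmod (l k ^ n - 1) \<le> real n * cmod (l k - 1)"
    using norm_power_diff[of "l k" 1 n] unimodular by simp
  then have "cmod (l k ^ n - 1) * cmod (f k x) \<le> (real n * cmod (l k - 1)) * (onorm (f k) * norm x)"
    by (intro mult_mono cfunctional_onorm functional_f) auto
  from mult_right_mono[OF this norm_ge_zero[of "e k"]] show ?thesis
    by (simp add: norm_scaleC norm_mult mult_ac)
qed

lemma summable_terms: "summable (\<lambda>k. ((l k ^ n - 1) * f k x) *\<^sub>C e k)"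
  by (rule summable_comparison_test'[OF summable_mult[OF summable_weights, of "real n * norm x"]])
    (rule term_bound)

lemma bounded_linear_T: "bounded_linear T"
proof -
  note s1 = summable_terms[of 1, simplified]
  have norms: "summable (\<lambda>k. norm (((l k - 1) * f k x) *\<^sub>C e k))" for x
    by (rule summable_comparison_test'[OF summable_mult[OF summable_weights, of "norm x"]])
      (use term_bound[of _ 1 x] in simp)
  let ?S = "\<lambda>x. \<Sum>k. ((l k - 1) * f k x) *\<^sub>C e k"
  have "bounded_linear ?S"
  proof (rule bounded_linear_intro)
    show "?S (x + y) = ?S x + ?S y" for x y
      by (simp add: suminf_add[OF s1 s1] cfunctional_add[OF functional_f] distrib_left scaleC_add_left)
    show "?S (r *\<^sub>R x) = r *\<^sub>R ?S x" for r x
    proof -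
      have "?S (r *\<^sub>R x) = (\<Sum>k. r *\<^sub>R ((l k - 1) * f k x) *\<^sub>C e k)"
        by (simp add: scaleR_scaleC[where 'a = 'a] cfunctional_scale[OF functional_f] mult_ac)
      also have "\<dots> = r *\<^sub>R ?S x"
        by (rule bounded_linear.suminf[OF bounded_linear_scaleR_right s1, symmetric])
      finally show ?thesis .
    qed
    show "norm (?S x) \<le> norm x * (\<Sum>k. cmod (l k - 1) * onorm (f k) * norm (e k))" for x
    proof -
      have "norm (?S x) \<le> (\<Sum>k. norm x * (cmod (l k - 1) * onorm (f k) * norm (e k)))"
        using term_bound[of _ 1 x]
        by (intro order_trans[OF summable_norm[OF norms]] suminf_le norms
            summable_mult[OF summable_weights]) simp
      then show ?thesis by (simp add: suminf_mult[OF summable_weights])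
    qed
  qed
  then show ?thesis unfolding T_def[abs_def]
    by (intro bounded_linear_add bounded_linear_ident)
qed

lemma T_scaleC: "T (c *\<^sub>C x) = c *\<^sub>C T x"
proof -
  have "(\<Sum>k. ((l k - 1) * f k (c *\<^sub>C x)) *\<^sub>C e k) = (\<Sum>k. c *\<^sub>C ((l k - 1) * f k x) *\<^sub>C e k)"
    by (simp add: cfunctional_scale[OF functional_f] mult_ac)
  also have "\<dots> = c *\<^sub>C (\<Sum>k. ((l k - 1) * f k x) *\<^sub>C e k)"
    by (rule bounded_linear.suminf[OF bounded_linear_scaleC_right summable_terms[of 1, simplified], symmetric])
  finally show ?thesis by (simp add: T_def scaleC_add_right)
qed

lemma continuous_clinear_T: "continuous_clinear T"
  unfolding continuous_clinear_def
proof
  have "module_hom scaleC scaleC T"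
    by unfold_locales (simp_all add: T_scaleC linear_add[OF bounded_linear.linear[OF bounded_linear_T]])
  then show "Vector_Spaces.linear scaleC scaleC T"
    by (simp add: Vector_Spaces.linear_def complex_vector.vector_space_axioms module_hom_def)
  show "continuous_on UNIV T"
    using bounded_linear_T by (rule linear_continuous_on)
qed

text \<open>Apart from \<open>\<phi> = f j\<close>, this applies to any other functional dual to the \<open>e k\<close>; with such a
  functional of moderate norm one reads off the \<open>j\<close>-th coordinate of an orbit.\<close>

lemma functional_dual_series:
  assumes "cfunctional \<phi>" and dual: "\<And>k. \<phi> (e k) = (if k = j then 1 else 0)"
  shows "\<phi> (x + (\<Sum>k. ((l k ^ n - 1) * f k y) *\<^sub>C e k)) = \<phi> x + (l j ^ n - 1) * f j y"
proof -
  have "\<phi> (\<Sum>k. ((l k ^ n - 1) * f k y) *\<^sub>C e k) = (\<Sum>k. \<phi> (((l k ^ n - 1) * f k y) *\<^sub>C e k))"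
    by (rule bounded_linear.suminf[OF cfunctional_bounded_linear[OF assms(1)] summable_terms])
  also have "\<dots> = (\<Sum>k. if k = j then (l k ^ n - 1) * f k y else 0)"
    by (intro suminf_cong) (simp add: cfunctional_scale[OF assms(1)] dual)
  also have "\<dots> = (l j ^ n - 1) * f j y"
    by (rule sums_unique[symmetric, OF sums_single])
  finally show ?thesis by (simp add: cfunctional_add[OF assms(1)])
qed

theorem T_power: "(T ^^ n) x = x + (\<Sum>k. ((l k ^ n - 1) * f k x) *\<^sub>C e k)"
proof (induction n)
  case (Suc n)
  let ?y = "(T ^^ n) x"
  have "f j ?y = l j ^ n * f j x" for j
    unfolding Suc using functional_dual_series[OF functional_f[of j], of j x n x]
    by (auto simp: biorthogonal algebra_simps)
  then have "(T ^^ Suc n) x = ?y + (\<Sum>k. ((l k ^ Suc n - l k ^ n) * f k x) *\<^sub>C e k)"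
    by (simp add: T_def[of ?y] algebra_simps)
  also have "(\<Sum>k. ((l k ^ Suc n - l k ^ n) * f k x) *\<^sub>C e k)
      = (\<Sum>k. ((l k ^ Suc n - 1) * f k x) *\<^sub>C e k - ((l k ^ n - 1) * f k x) *\<^sub>C e k)"
    by (simp add: complex_vector.scale_left_diff_distrib left_diff_distrib)
  also have "\<dots> = (\<Sum>k. ((l k ^ Suc n - 1) * f k x) *\<^sub>C e k) - (\<Sum>k. ((l k ^ n - 1) * f k x) *\<^sub>C e k)"
    by (rule suminf_diff[symmetric, OF summable_terms summable_terms])
  finally show ?case by (simp add: Suc)
qed simp

end

section \<open>Rotations of the unit circle\<close>

lemma norm_cis_minus_one: "cmod (cis t - 1) = 2 * \<bar>sin (t / 2)\<bar>"
  using dist_exp_i_1[of t] by (simp add: cis_conv_exp)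

lemma norm_cis_minus_one_le: "cmod (cis t - 1) \<le> \<bar>t\<bar>"
  using abs_sin_x_le_abs_x[of "t / 2"] by (simp add: norm_cis_minus_one)

text \<open>A weak form of Jordan's inequality, from the third-order Taylor bound.\<close>

lemma sin_ge_third:
  fixes x :: real
  assumes "0 \<le> x" "x \<le> pi / 2"
  shows "x / 3 \<le> sin x"
proof -
  have "\<bar>sin x - x\<bar> \<le> \<bar>x\<bar> ^ 3 / 6"
    using Maclaurin_sin_bound[of x 3]
    by (simp add: numeral_3_eq_3 sin_coeff_def fact_numeral field_simps)
  moreover have "x ^ 3 \<le> x * 4"
  proof -
    have "x * x \<le> 2 * 2" using assms pi_half_less_two by (intro mult_mono) auto
    then show ?thesis using assms mult_left_mono[of "x * x" 4 x] by (simp add: power3_eq_cube mult_ac)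
  qed
  ultimately show ?thesis using assms by (simp add: abs_if split: if_splits)
qed

lemma norm_cis_power_minus_one_ge:
  assumes "2 * n < M"
  shows "real n / real M \<le> cmod (cis (2 * pi / real M) ^ n - 1)"
proof -
  let ?x = "pi * (real n / real M)"
  have x: "0 \<le> ?x" "?x \<le> pi / 2"
    using assms by (simp_all add: field_simps)
  have "2 * (real n / real M) \<le> ?x" "0 \<le> real n / real M"
    by (rule mult_right_mono[OF pi_ge_two]) simp_all
  moreover have "a \<le> 2 * (b / 3)" if "2 * a \<le> b" "0 \<le> a" for a b :: real
    using that by simp
  ultimately have "real n / real M \<le> 2 * (?x / 3)" by blast
  also have "\<dots> \<le> 2 * sin ?x" using sin_ge_third[OF x] by simp
  also have "\<dots> \<le> cmod (cis (2 * pi / real M) ^ n - 1)"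
    by (simp add: Complex.DeMoivre norm_cis_minus_one mult_ac)
  finally show ?thesis .
qed

lemma cis_power_eq_one:
  assumes "M dvd n" "M > 0"
  shows "cis (2 * pi / real M) ^ n = 1"
proof -
  obtain c where "n = M * c" using assms(1) ..
  then have "real n * (2 * pi / real M) = 2 * pi * real c" using assms(2) by simp
  then show ?thesis by (simp only: Complex.DeMoivre) (simp only: cis_multiple_2pi Ints_of_nat)
qed

section \<open>The operator\<close>

text \<open>The index \<open>k\<close> of the operator corresponds to the index \<open>k + 2\<close> of the biorthogonal
  sequence; the first two coordinates \<open>vs 0\<close> and \<open>vs 1\<close> are left invariant and parametrise the
  linear forms \<open>w k\<close>, whose kernels in the \<open>(vs 0, vs 1)\<close>-plane are the lines of slope \<open>q k\<close>.\<close>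

locale wild_operator =
  fixes v :: "nat \<Rightarrow> 'a::complex_banach" and vs :: "nat \<Rightarrow> 'a \<Rightarrow> complex" and q :: "nat \<Rightarrow> complex"
  assumes functional_vs: "cfunctional (vs n)"
    and biorthogonal_vs: "vs i (v j) = (if i = j then 1 else 0)"
    and dense_span: "closure (cspan (range v)) = UNIV"
    and q_dense: "\<epsilon> > 0 \<Longrightarrow> \<exists>d. dist d z < \<epsilon> \<and> infinite {k. q k = d}"
begin

definition e :: "nat \<Rightarrow> 'a" where "e k = v (k + 2)"

definition w :: "nat \<Rightarrow> 'a \<Rightarrow> complex" where "w k x = vs 1 x - q k * vs 0 x"

text \<open>An upper bound for the norm of the coordinate functional dual to \<open>e k\<close>, kept at least \<open>1\<close>.\<close>

definition B :: "nat \<Rightarrow> real" where "B k = 1 + onorm (vs (k + 2))"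

text \<open>\<open>A (k + 1) / m k\<close> will bound the norm of the rank-one summand of index \<open>k + 1\<close> of the operator.
  The factors \<open>N\<close> of the divisibility chain \<open>m\<close> are chosen to make the norm of the summand of index \<open>k + 2\<close>
  small even after multiplication by \<open>m k\<close>; being at least \<open>2\<close>, they make \<open>m\<close> unbounded.\<close>

definition A :: "nat \<Rightarrow> real" where
  "A k = 2 * pi * B k * (1 + 2 * real k * onorm (w k)) * norm (e k)"

definition N :: "nat \<Rightarrow> nat" where "N k = nat \<lceil>A (Suc k) * 2 ^ Suc k\<rceil> + 2"

definition m :: "nat \<Rightarrow> nat" where "m k = (\<Prod>i<k. N (Suc i))"

text \<open>Note \<open>m 0 = 1\<close>, so \<open>l 0 = 1\<close> and the summand of index \<open>0\<close> vanishes.\<close>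

definition l :: "nat \<Rightarrow> complex" where "l k = cis (2 * pi / real (m k))"

text \<open>For \<open>k > 0\<close>, \<open>N k = m k / m (k - 1)\<close>. The coefficient \<open>2 k B k N k\<close> of \<open>w k\<close> is so large that a
  nonzero value \<open>w (k + 1) x\<close>, magnified by \<open>k + 1\<close>, shows up in \<open>T\<^sup>n x\<close> for \<open>n\<close> between
  \<open>m k / 2\<close> and \<open>m (k + 1) / 2\<close>.\<close>

definition f :: "nat \<Rightarrow> 'a \<Rightarrow> complex" where
  "f k x = vs (k + 2) x + complex_of_real (2 * real k * B k * real (N k)) * w k x"

lemma functional_w: "cfunctional (w k)"
  unfolding w_def[abs_def] by (intro cfunctional_minus cfunctional_times functional_vs)

lemma functional_f: "cfunctional (f k)"
  unfolding f_def[abs_def] by (intro cfunctional_plus cfunctional_times functional_vs functional_w)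

lemma biorthogonal_f: "f i (e j) = (if i = j then 1 else 0)"
  by (simp add: f_def e_def w_def biorthogonal_vs)

lemma B_ge_1: "B k \<ge> 1"
  by (simp add: B_def onorm_pos_le cfunctional_bounded_linear[OF functional_vs])

lemma norm_vs_le: "cmod (vs (k + 2) x) \<le> B k * norm x"
proof -
  have "cmod (vs (k + 2) x) \<le> onorm (vs (k + 2)) * norm x"
    by (rule cfunctional_onorm[OF functional_vs])
  also have "\<dots> \<le> B k * norm x" by (intro mult_right_mono) (auto simp: B_def)
  finally show ?thesis .
qed

lemma N_ge: "real (N k) \<ge> A (Suc k) * 2 ^ Suc k" "N k \<ge> 2"
  unfolding N_def by linarith+

lemma m_Suc: "m (Suc k) = m k * N (Suc k)"
  by (simp add: m_def)

lemma m_ge_power: "m k \<ge> 2 ^ k"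
proof (induction k)
  case (Suc k)
  show ?case using mult_mono[OF Suc N_ge(2)[of "Suc k"]] by (simp add: m_Suc mult.commute)
qed (simp add: m_def)

lemma m_pos: "m k > 0"
  using m_ge_power[of k] by (meson less_le_trans zero_less_power zero_less_numeral)

lemma m_dvd: "i \<le> j \<Longrightarrow> m i dvd m j"
  by (induction j rule: dec_induct) (auto simp: m_Suc)

lemma m_mono: "i \<le> j \<Longrightarrow> m i \<le> m j"
  using m_dvd m_pos dvd_imp_le by blast

lemma onorm_f_le: "onorm (f k) \<le> real (N k) * (B k * (1 + 2 * real k * onorm (w k)))"
proof (rule onorm_bound)
  show "0 \<le> real (N k) * (B k * (1 + 2 * real k * onorm (w k)))"
    using B_ge_1[of k] onorm_pos_le[OF cfunctional_bounded_linear[OF functional_w[of k]]]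
    by (intro mult_nonneg_nonneg) auto
  fix x
  have "cmod (f k x) \<le> cmod (vs (k + 2) x) + 2 * real k * B k * real (N k) * cmod (w k x)"
    using B_ge_1[of k] unfolding f_def
    by (intro order_trans[OF norm_triangle_ineq]) (simp add: norm_mult)
  also have "\<dots> \<le> real (N k) * (B k * norm x) + 2 * real k * B k * real (N k) * (onorm (w k) * norm x)"
  proof (intro add_mono mult_left_mono cfunctional_onorm functional_w)
    have "0 \<le> B k * norm x" using B_ge_1[of k] by simp
    then have "1 * (B k * norm x) \<le> real (N k) * (B k * norm x)"
      using N_ge(2)[of k] by (intro mult_right_mono) auto
    then show "cmod (vs (k + 2) x) \<le> real (N k) * (B k * norm x)"
      using norm_vs_le[of k x] by linarith
  qed (use B_ge_1[of k] in auto)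
  also have "\<dots> = real (N k) * (B k * (1 + 2 * real k * onorm (w k))) * norm x"
    by (simp add: algebra_simps)
  finally show "cmod (f k x) \<le> real (N k) * (B k * (1 + 2 * real k * onorm (w k))) * norm x" .
qed

lemma weight_le: "cmod (l (Suc k) - 1) * onorm (f (Suc k)) * norm (e (Suc k)) \<le> A (Suc k) / real (m k)"
proof -
  let ?j = "Suc k"
  have "cmod (l ?j - 1) * onorm (f ?j) * norm (e ?j)
      \<le> 2 * pi / real (m ?j) * (real (N ?j) * (B ?j * (1 + 2 * real ?j * onorm (w ?j)))) * norm (e ?j)"
    using norm_cis_minus_one_le[of "2 * pi / real (m ?j)"]
    by (intro mult_right_mono mult_mono onorm_f_le)
      (auto simp: l_def onorm_pos_le cfunctional_bounded_linear[OF functional_f])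
  also have "\<dots> = A ?j / real (m k)"
    using m_pos[of k] N_ge(2)[of ?j] by (simp add: m_Suc A_def field_simps)
  finally show ?thesis .
qed

text \<open>This gives the continuity of the operator, and smallness of the part of the series for \<open>T\<^sup>n\<close> from index \<open>k + 2\<close> on when
  \<open>n\<close> is a bounded multiple of \<open>m k\<close>.\<close>

lemma weight_decay:
  "cmod (l (k + 2) - 1) * onorm (f (k + 2)) * norm (e (k + 2)) \<le> (1 / 2) ^ (k + 2) / real (m k)"
proof -
  have "A (k + 2) * 2 ^ (k + 2) \<le> real (N (Suc k))" using N_ge(1)[of "Suc k"] by simp
  then have "A (k + 2) / real (m (Suc k)) \<le> (1 / 2) ^ (k + 2) / real (m k)"
    using m_pos[of k] N_ge(2)[of "Suc k"] by (simp add: m_Suc field_simps)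
  then show ?thesis using weight_le[of "Suc k"] by simp
qed

sublocale diagonal_perturbation e f l
proof
  show "summable (\<lambda>k. cmod (l k - 1) * onorm (f k) * norm (e k))"
  proof (rule summable_iff_shift[THEN iffD1])
    show "summable (\<lambda>k. cmod (l (k + 2) - 1) * onorm (f (k + 2)) * norm (e (k + 2)))"
    proof (rule summable_comparison_test'[where N = 0])
      show "summable (\<lambda>k. (1 / 2 :: real) ^ (k + 2))"
        by (subst summable_iff_shift) (simp add: summable_geometric)
      fix k :: nat
      have "(1 / 2) ^ (k + 2) / real (m k) \<le> (1 / 2 :: real) ^ (k + 2)"
        using m_pos[of k] by (simp add: field_simps)
      with weight_decay[of k]
      show "norm (cmod (l (k + 2) - 1) * onorm (f (k + 2)) * norm (e (k + 2))) \<le> (1 / 2) ^ (k + 2)"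
        by (simp add: onorm_pos_le cfunctional_bounded_linear[OF functional_f])
    qed
  qed
qed (simp_all add: functional_f biorthogonal_f l_def)

subsection \<open>Orbits that escape to infinity\<close>

text \<open>Apply the functional \<open>vs (k + 3)\<close>, dual to \<open>e (k + 1)\<close>, to the series for \<open>T\<^sup>n x\<close>; its norm is
  at most \<open>B (k + 1)\<close>, the factor by which the coefficient of \<open>w (k + 1)\<close> was enlarged.\<close>

lemma norm_power_ge:
  assumes n: "m k \<le> 2 * n" "2 * n < m (Suc k)"
  shows "real (Suc k) * cmod (w (Suc k) x) \<le> norm ((T ^^ n) x) + 3 * norm x"
proof -
  let ?j = "Suc k" and ?y = "(T ^^ n) x"
  let ?c = "cmod (l ?j ^ n - 1)" and ?b = "2 * real ?j * B ?j * real (N ?j)"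
  have B: "B ?j > 0" using B_ge_1[of ?j] by linarith
  have c2: "?c \<le> 2"
    using norm_triangle_ineq4[of "l ?j ^ n" 1] by (simp add: unimodular norm_power)
  have "real (m k) \<le> 2 * real n" using n(1) by linarith
  then have "1 / (2 * real (N ?j)) \<le> real n / real (m ?j)"
    using m_pos[of k] N_ge(2)[of ?j] by (simp add: m_Suc field_simps)
  also have "\<dots> \<le> ?c" unfolding l_def by (rule norm_cis_power_minus_one_ge[OF n(2)])
  finally have "1 \<le> ?c * (2 * real (N ?j))" using N_ge(2)[of ?j] by (simp add: field_simps)
  moreover have "0 \<le> real ?j * B ?j * cmod (w ?j x)" using B by simp
  ultimately have "real ?j * B ?j * cmod (w ?j x) * 1
      \<le> real ?j * B ?j * cmod (w ?j x) * (?c * (2 * real (N ?j)))"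
    by (rule mult_left_mono)
  then have "real ?j * B ?j * cmod (w ?j x) \<le> ?c * (?b * cmod (w ?j x))"
    by (simp only: mult_1_right mult_ac)
  also have "?b * cmod (w ?j x) = cmod (f ?j x - vs (?j + 2) x)"
    unfolding f_def add_diff_cancel_left' norm_mult norm_of_real using B by simp
  also have "?c * \<dots> = cmod ((l ?j ^ n - 1) * f ?j x - (l ?j ^ n - 1) * vs (?j + 2) x)"
    by (simp add: right_diff_distrib flip: norm_mult)
  also have "(l ?j ^ n - 1) * f ?j x = vs (?j + 2) ?y - vs (?j + 2) x"
    using functional_dual_series[OF functional_vs[of "?j + 2"], of ?j x n x]
    by (simp add: T_power e_def biorthogonal_vs)
  also have "cmod (vs (?j + 2) ?y - vs (?j + 2) x - (l ?j ^ n - 1) * vs (?j + 2) x)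
      \<le> cmod (vs (?j + 2) ?y) + cmod (vs (?j + 2) x) + ?c * cmod (vs (?j + 2) x)"
    using norm_triangle_ineq4[of "vs (?j + 2) ?y - vs (?j + 2) x" "(l ?j ^ n - 1) * vs (?j + 2) x"]
      norm_triangle_ineq4[of "vs (?j + 2) ?y" "vs (?j + 2) x"] by (simp add: norm_mult)
  also have "\<dots> \<le> B ?j * norm ?y + B ?j * norm x + 2 * (B ?j * norm x)"
    by (intro add_mono mult_mono norm_vs_le c2) auto
  finally have "B ?j * (real ?j * cmod (w ?j x)) \<le> B ?j * (norm ?y + 3 * norm x)"
    by (simp add: algebra_simps)
  then show ?thesis using B by (simp only: mult_le_cancel_left_pos)
qed

text \<open>The index \<open>k\<close> does not depend on \<open>x\<close>, so the bound can be used for two vectors at the same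
  time \<open>n\<close>.\<close>

lemma norm_power_ge_uniform:
  assumes "n \<ge> m K"
  obtains k where "k \<ge> K" "\<And>x. real k * cmod (w k x) \<le> norm ((T ^^ n) x) + 3 * norm x"
proof -
  have "2 * n < 2 ^ (2 * n)" by (rule less_exp)
  then have ex: "2 * n < m (2 * n)" using m_ge_power[of "2 * n"] by linarith
  define k where "k = (LEAST k. 2 * n < m k)"
  have k: "2 * n < m k" unfolding k_def by (rule LeastI[of "\<lambda>k. 2 * n < m k", OF ex])
  have "n > 0" using assms m_pos[of K] by simp
  then obtain i where i: "k = Suc i" using k by (cases k) (auto simp: m_def)
  have "m i \<le> 2 * n" using not_less_Least[of i "\<lambda>k. 2 * n < m k"] i by (simp add: k_def)
  have "\<not> k \<le> K" using m_mono[of k K] k assms by auto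
  then show thesis
    using that[of k] norm_power_ge[OF \<open>m i \<le> 2 * n\<close>] k i by auto
qed

lemma no_joint_limit:
  assumes "strict_mono \<omega>" and x: "(\<lambda>n. (T ^^ \<omega> n) x) \<longlonglongrightarrow> a" and y: "(\<lambda>n. (T ^^ \<omega> n) y) \<longlonglongrightarrow> b"
    and "\<delta> > 0" "s \<ge> 0" "t \<ge> 0" and w: "\<And>k. \<delta> \<le> s * cmod (w k x) + t * cmod (w k y)"
  shows False
proof -
  obtain Mx where Mx: "\<And>n. norm ((T ^^ \<omega> n) x) \<le> Mx"
    using convergent_imp_Bseq[OF convergentI[OF x]] by (auto simp: Bseq_def)
  obtain My where My: "\<And>n. norm ((T ^^ \<omega> n) y) \<le> My"
    using convergent_imp_Bseq[OF convergentI[OF y]] by (auto simp: Bseq_def)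
  define C where "C = s * (Mx + 3 * norm x) + t * (My + 3 * norm y)"
  obtain K :: nat where K: "real K > C / \<delta>" using reals_Archimedean2 by blast
  have "\<omega> (m K) \<ge> m K" using assms(1) by (rule strict_mono_imp_increasing)
  then obtain k where k: "k \<ge> K"
    "\<And>x. real k * cmod (w k x) \<le> norm ((T ^^ \<omega> (m K)) x) + 3 * norm x"
    using norm_power_ge_uniform by blast
  have "real K * \<delta> \<le> real k * \<delta>" using k(1) \<open>\<delta> > 0\<close> by simp
  also have "\<dots> \<le> real k * (s * cmod (w k x) + t * cmod (w k y))"
    by (intro mult_left_mono w) simp
  also have "\<dots> = s * (real k * cmod (w k x)) + t * (real k * cmod (w k y))"
    by (simp add: algebra_simps)
  also have "\<dots> \<le> C"
    unfolding C_def using k(2)[of x] k(2)[of y] Mx[of "m K"] My[of "m K"] assms(5,6)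
    by (intro add_mono mult_left_mono) linarith+
  finally show False using K \<open>\<delta> > 0\<close> by (simp add: field_simps)
qed

text \<open>The determinant of the first two coordinates of \<open>x\<close> and \<open>y\<close>.\<close>

definition minor :: "'a \<Rightarrow> 'a \<Rightarrow> complex" where
  "minor x y = vs 0 x * vs 1 y - vs 0 y * vs 1 x"

text \<open>The slopes \<open>q k\<close> cancel, so the right-hand side does not depend on \<open>k\<close>.\<close>

lemma minor_eq: "minor x y = vs 0 x * w k y - vs 0 y * w k x"
  by (simp add: minor_def w_def algebra_simps)

lemma dense_meets_minor_nonzero:
  assumes "closure D = (UNIV :: ('a \<times> 'a) set)"
  obtains x y where "(x, y) \<in> D" "minor x y \<noteq> 0"
proof -
  let ?U = "(\<lambda>p. minor (fst p) (snd p)) -` (- {0})"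
  have cont: "continuous_on UNIV (\<lambda>p :: 'a \<times> 'a. minor (fst p) (snd p))"
    unfolding minor_def
    by (intro continuous_on_diff continuous_on_mult continuous_on_fst continuous_on_snd continuous_on_id
        bounded_linear.continuous_on[OF cfunctional_bounded_linear[OF functional_vs]])
  have "open ?U" by (rule open_vimage[OF _ cont]) auto
  moreover have "(v 0, v 1) \<in> ?U" by (simp add: minor_def biorthogonal_vs)
  then have "?U \<inter> closure D \<noteq> {}" unfolding assms by blast
  ultimately have "?U \<inter> D \<noteq> {}"
    by (simp only: open_Int_closure_eq_empty not_False_eq_True)
  then obtain p where "p \<in> ?U" "p \<in> D" by blast
  then show thesis using that[of "fst p" "snd p"] by simp
qed

lemma funpow_map_prod: "(map_prod T T ^^ n) (x, y) = ((T ^^ n) x, (T ^^ n) y)"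
  by (induction n) auto

theorem Sigma_op_sum_empty: "Sigma_op (map_prod T T) = {}"
proof (rule ccontr)
  assume "Sigma_op (map_prod T T) \<noteq> {}"
  then obtain g where "closure (recurrence_set (map_prod T T) g) = UNIV"
    by (auto simp: Sigma_op_def)
  then obtain x y where xy: "(x, y) \<in> recurrence_set (map_prod T T) g" and d: "minor x y \<noteq> 0"
    by (rule dense_meets_minor_nonzero)
  obtain \<omega> where om: "strict_mono \<omega>" "(\<lambda>n. ((T ^^ \<omega> n) x, (T ^^ \<omega> n) y)) \<longlonglongrightarrow> g (x, y)"
    using xy by (auto simp: recurrence_set_def funpow_map_prod)
  have "cmod (minor x y) \<le> cmod (vs 0 y) * cmod (w k x) + cmod (vs 0 x) * cmod (w k y)" for k
    unfolding minor_eq[of x y k]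
    using norm_triangle_ineq4[of "vs 0 x * w k y" "vs 0 y * w k x"] by (simp add: norm_mult)
  then show False
    using no_joint_limit[OF om(1) tendsto_fst[OF om(2), simplified] tendsto_snd[OF om(2), simplified],
        of "cmod (minor x y)"
          "cmod (vs 0 y)" "cmod (vs 0 x)"] d by simp
qed

theorem not_dense_lineable_recurrence_set: "\<not> dense_lineable (recurrence_set T g)"
proof
  assume "dense_lineable (recurrence_set T g)"
  then obtain V where V: "csubspace V" "closure V = UNIV" "V \<subseteq> recurrence_set T g \<union> {0}"
    by (auto simp: dense_lineable_def)
  have "closure (V \<times> V) = UNIV" by (simp add: closure_Times V(2))
  then obtain x y where xy: "(x, y) \<in> V \<times> V" and d: "minor x y \<noteq> 0"
    by (rule dense_meets_minor_nonzero)
  define z where "z = vs 0 x *\<^sub>C y - vs 0 y *\<^sub>C x"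
  have "z \<in> V" unfolding z_def using xy
    by (auto intro!: complex_vector.subspace_diff[OF V(1)] complex_vector.subspace_scale[OF V(1)])
  have wz: "w k z = minor x y" for k
    by (simp add: z_def minor_eq[of x y k] cfunctional_diff[OF functional_w]
        cfunctional_scale[OF functional_w])
  have "z \<noteq> 0"
    using wz[of 0] d cfunctional_scale[OF functional_w, of 0 0 z] by auto
  then obtain \<omega> where om: "strict_mono \<omega>" "(\<lambda>n. (T ^^ \<omega> n) z) \<longlonglongrightarrow> g z"
    using V(3) \<open>z \<in> V\<close> by (auto simp: recurrence_set_def)
  show False
    using no_joint_limit[OF om(1) om(2) om(2), of "cmod (minor x y)" 1 0] d by (simp add: wz)
qed

subsection \<open>Arithmetic progressions of return times\<close>

lemma finite_support:
  assumes "x \<in> cspan (range v)"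
  shows "\<exists>K. \<forall>k\<ge>K. vs k x = 0"
  using assms
proof (rule complex_vector.span_induct[where P = "\<lambda>x. \<exists>K. \<forall>k\<ge>K. vs k x = 0"])
  have z: "vs k 0 = 0" for k
    using cfunctional_scale[OF functional_vs, of k 0 0] by simp
  show "csubspace {x. \<exists>K. \<forall>k\<ge>K. vs k x = 0}"
  proof (rule complex_vector.subspaceI)
    fix x y assume "x \<in> {x. \<exists>K. \<forall>k\<ge>K. vs k x = 0}" "y \<in> {x. \<exists>K. \<forall>k\<ge>K. vs k x = 0}"
    then obtain K L where "\<forall>k\<ge>K. vs k x = 0" "\<forall>k\<ge>L. vs k y = 0" by auto
    then have "\<forall>k\<ge>max K L. vs k (x + y) = 0" by (simp add: cfunctional_add[OF functional_vs])
    then show "x + y \<in> {x. \<exists>K. \<forall>k\<ge>K. vs k x = 0}" by blast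
  qed (auto simp: z cfunctional_scale[OF functional_vs])
  fix x assume "x \<in> range v"
  then obtain i where "x = v i" by auto
  then have "\<forall>k\<ge>Suc i. vs k x = 0" by (simp add: biorthogonal_vs)
  then show "\<exists>K. \<forall>k\<ge>K. vs k x = 0" by blast
qed

text \<open>Summands of index at most \<open>k\<close> vanish because \<open>l j ^ n = 1\<close>, the summand of index \<open>k + 1\<close> by the
  first assumption; the rest is dominated by a geometric series.\<close>

lemma return_estimate:
  assumes "f (Suc k) x = 0" and "m k dvd n"
  shows "norm ((T ^^ n) x - x) \<le> real n / real (m k) * norm x * (1 / 2) ^ Suc k"
proof -
  let ?g = "\<lambda>j. ((l j ^ n - 1) * f j x) *\<^sub>C e j"
  let ?C = "real n / real (m k) * norm x"
  have zero: "?g j = 0" if "j < k + 2" for j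
  proof (cases "j = Suc k")
    case False
    with that have "j \<le> k" by simp
    then have "m j dvd n" by (rule dvd_trans[OF m_dvd assms(2)])
    then have "l j ^ n = 1" unfolding l_def by (rule cis_power_eq_one[OF _ m_pos])
    then show ?thesis by simp
  next
    case True
    then show ?thesis using assms(1) by simp
  qed
  have bound: "norm (?g (i + (k + 2))) \<le> ?C * (1 / 2) ^ (k + 2) * (1 / 2) ^ i" for i
  proof -
    have idx: "i + (k + 2) = i + k + 2" by simp
    have "norm (?g (i + k + 2)) \<le> real n * norm x * ((1 / 2) ^ (i + k + 2) / real (m (i + k)))"
      by (rule order_trans[OF term_bound mult_left_mono[OF weight_decay]]) simp
    also have "\<dots> \<le> real n * norm x * ((1 / 2) ^ (i + k + 2) / real (m k))"
      using m_mono[of k "i + k"] m_pos[of k] m_pos[of "i + k"]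
      by (intro mult_left_mono divide_left_mono) simp_all
    also have "\<dots> = ?C * (1 / 2) ^ (k + 2) * (1 / 2) ^ i"
      by (simp only: power_add times_divide_eq_left times_divide_eq_right mult_ac)
    finally show ?thesis unfolding idx .
  qed
  have geo: "(\<lambda>i. ?C * (1 / 2) ^ (k + 2) * (1 / 2 :: real) ^ i) sums (?C * (1 / 2) ^ (k + 2) * (1 / (1 - 1 / 2)))"
    by (intro sums_mult geometric_sums) simp
  have "(T ^^ n) x - x = (\<Sum>j. ?g j)" by (simp add: T_power)
  also have "\<dots> = (\<Sum>i. ?g (i + (k + 2)))"
  proof -
    have "(\<Sum>j. ?g j) = (\<Sum>i. ?g (i + (k + 2))) + (\<Sum>j<k + 2. ?g j)"
      by (rule suminf_split_initial_segment[OF summable_terms])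
    moreover have "(\<Sum>j<k + 2. ?g j) = 0" by (intro sum.neutral ballI zero) simp
    ultimately show ?thesis by (simp only: add_0_right)
  qed
  finally have series: "(T ^^ n) x - x = (\<Sum>i. ?g (i + (k + 2)))" .
  have "norm ((T ^^ n) x - x) \<le> (\<Sum>i. ?C * (1 / 2) ^ (k + 2) * (1 / 2 :: real) ^ i)"
    unfolding series by (rule norm_suminf_le[OF bound sums_summable[OF geo]])
  also have "\<dots> = ?C * (1 / 2) ^ (k + 2) * (1 / (1 - 1 / 2))"
    by (rule sums_unique[symmetric, OF geo])
  finally show ?thesis by simp
qed

lemma AP_recurrent_pointI:
  assumes "x \<in> cspan (range v)" and inf: "infinite {k. w k x = 0}"
  shows "AP_recurrent_point T x"
  unfolding AP_recurrent_point_def AP_def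
proof (intro allI impI CollectI)
  fix U L assume U: "open U \<and> x \<in> U"
  then obtain \<epsilon> where eps: "\<epsilon> > 0" "\<And>y. dist y x < \<epsilon> \<Longrightarrow> y \<in> U"
    unfolding open_dist by blast
  obtain K where K: "\<And>k. k \<ge> K \<Longrightarrow> vs k x = 0" using finite_support[OF assms(1)] by blast
  have "(\<lambda>k. real L * norm x * (1 / 2) ^ k) \<longlonglongrightarrow> real L * norm x * 0"
    by (intro tendsto_mult_left LIMSEQ_power_zero) simp
  then have "\<forall>\<^sub>F k in sequentially. real L * norm x * (1 / 2) ^ k < \<epsilon>"
    using eps(1) by (intro order_tendstoD(2)) auto
  then obtain K' where K': "\<And>k. k \<ge> K' \<Longrightarrow> real L * norm x * (1 / 2) ^ k < \<epsilon>"
    by (auto simp: eventually_sequentially)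
  obtain k0 where k0: "k0 > max K K'" "w k0 x = 0"
    using inf unfolding infinite_nat_iff_unbounded by blast
  then obtain k where k: "k0 = Suc k" by (cases k0) auto
  have fk: "f (Suc k) x = 0" using k0 k K[of "Suc k + 2"] by (simp add: f_def)
  have "0 + i * m k \<in> {n. (T ^^ n) x \<in> U}" if "i < L" for i
  proof -
    have "dist ((T ^^ (i * m k)) x) x \<le> real i * norm x * (1 / 2) ^ Suc k"
      using return_estimate[OF fk, of "i * m k"] m_pos[of k] by (simp add: dist_norm)
    also have "\<dots> \<le> real L * norm x * (1 / 2) ^ Suc k"
      using that by (intro mult_right_mono) auto
    also have "\<dots> < \<epsilon>" using K'[of "Suc k"] k0 k by simp
    finally show ?thesis using eps(2) by simp
  qed
  then show "\<exists>a d. d > 0 \<and> (\<forall>i<L. a + i * d \<in> {n. (T ^^ n) x \<in> U})"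
    using m_pos[of k] by blast
qed

text \<open>A vector of the dense span is moved slightly along \<open>v 0\<close>, to make its first coordinate nonzero,
  and then along \<open>v 1\<close>, to bring the quotient of its first two coordinates into the range of \<open>q\<close>.\<close>

theorem AP_recurrent_T: "AP_recurrent T"
proof -
  have "\<exists>y\<in>{x. AP_recurrent_point T x}. dist y x < \<epsilon>" if "\<epsilon> > 0" for x \<epsilon>
  proof -
    have "x \<in> closure (cspan (range v))" using dense_span by simp
    moreover have "\<epsilon> / 3 > 0" using that by simp
    ultimately obtain y where y: "y \<in> cspan (range v)" "dist y x < \<epsilon> / 3"
      unfolding closure_approachable by blast
    have v_span: "c *\<^sub>C v i \<in> cspan (range v)" for c i
      by (intro complex_vector.span_scale complex_vector.span_base) auto
    have small: "\<exists>c>0. cmod (complex_of_real c) * norm (v i) < \<epsilon> / 3" for i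
    proof (intro exI conjI)
      have pos: "norm (v i) + 1 > 0" by (simp add: add_nonneg_pos)
      then show "\<epsilon> / 3 / (norm (v i) + 1) > 0" using that by simp
      have "norm (v i) / (norm (v i) + 1) < 1" using pos by simp
      from mult_strict_left_mono[OF this, of "\<epsilon> / 3"]
      show "cmod (complex_of_real (\<epsilon> / 3 / (norm (v i) + 1))) * norm (v i) < \<epsilon> / 3"
        using pos that by (simp only: norm_of_real abs_of_pos divide_pos_pos) simp
    qed
    obtain c where c: "c > 0" "cmod (complex_of_real c) * norm (v 0) < \<epsilon> / 3" using small by blast
    define y' where "y' = (if vs 0 y = 0 then y + complex_of_real c *\<^sub>C v 0 else y)"
    have y': "y' \<in> cspan (range v)" unfolding y'_def
      using complex_vector.span_add[OF y(1) v_span] y(1) by simp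
    have "dist y' y < \<epsilon> / 3" using c that by (simp add: y'_def dist_norm norm_scaleC)
    have a: "vs 0 y' \<noteq> 0" using c(1)
      by (simp add: y'_def cfunctional_add[OF functional_vs] cfunctional_scale[OF functional_vs]
          biorthogonal_vs)
    obtain c' where c': "c' > 0" "cmod (complex_of_real c') * norm (v 1) < \<epsilon> / 3" using small by blast
    have "c' / cmod (vs 0 y') > 0" using c'(1) a by simp
    from q_dense[OF this, of "vs 1 y' / vs 0 y'"] obtain d
      where d: "dist d (vs 1 y' / vs 0 y') < c' / cmod (vs 0 y')" "infinite {k. q k = d}" by blast
    define r where "r = d * vs 0 y' - vs 1 y'"
    have "r = (d - vs 1 y' / vs 0 y') * vs 0 y'" using a by (simp add: r_def field_simps)
    then have "cmod r = cmod (d - vs 1 y' / vs 0 y') * cmod (vs 0 y')" by (simp only: norm_mult)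
    then have "cmod r < c'" using d(1) a by (simp add: dist_norm pos_less_divide_eq)
    define z where "z = y' + r *\<^sub>C v 1"
    have "z \<in> cspan (range v)" unfolding z_def by (rule complex_vector.span_add[OF y' v_span])
    moreover have "{k. q k = d} \<subseteq> {k. w k z = 0}"
      by (auto simp: w_def z_def r_def cfunctional_add[OF functional_vs]
          cfunctional_scale[OF functional_vs] biorthogonal_vs)
    with d(2) have "infinite {k. w k z = 0}" using finite_subset by blast
    ultimately have "AP_recurrent_point T z" by (rule AP_recurrent_pointI)
    moreover have "cmod r * norm (v 1) \<le> c' * norm (v 1)"
      using \<open>cmod r < c'\<close> by (intro mult_right_mono) auto
    then have "dist z y' < \<epsilon> / 3" using c' by (simp add: z_def dist_norm norm_scaleC)
    then have "dist z x < \<epsilon>"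
      using dist_triangle[of z x y'] dist_triangle[of y' x y] y(2) \<open>dist y' y < \<epsilon> / 3\<close> by linarith
    ultimately show ?thesis by blast
  qed
  then show ?thesis unfolding AP_recurrent_def by (auto simp: closure_approachable)
qed

end

section \<open>Existence\<close>

lemma exists_infinitely_repeating_dense_sequence:
  obtains q :: "nat \<Rightarrow> 'a::{metric_space, second_countable_topology}"
  where "\<And>z \<epsilon>. \<epsilon> > 0 \<Longrightarrow> \<exists>d. dist d z < \<epsilon> \<and> infinite {k. q k = d}"
proof -
  obtain D :: "'a set" where D: "countable D" "\<And>X. open X \<Longrightarrow> X \<noteq> {} \<Longrightarrow> \<exists>d\<in>D. d \<in> X"
    using countable_dense_setE by blast
  define q where "q k = from_nat_into D (fst (prod_decode k))" for k
  have "\<exists>d. dist d z < \<epsilon> \<and> infinite {k. q k = d}" if "\<epsilon> > 0" for z \<epsilon>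
  proof -
    have "ball z \<epsilon> \<noteq> {}" using that by simp
    then obtain d where d: "d \<in> D" "d \<in> ball z \<epsilon>" using D(2)[OF open_ball] by blast
    obtain i where i: "from_nat_into D i = d" using from_nat_into_surj[OF D(1) d(1)] by blast
    have "range (\<lambda>j. prod_encode (i, j)) \<subseteq> {k. q k = d}" by (auto simp: q_def i)
    moreover have "inj (\<lambda>j. prod_encode (i, j))" by (auto intro: injI)
    then have "infinite (range (\<lambda>j. prod_encode (i, j)))" using finite_imageD by blast
    ultimately have "infinite {k. q k = d}" using finite_subset by blast
    then show ?thesis using d(2) by (auto simp: dist_commute)
  qed
  then show thesis by (rule that)
qed

theorem theorem2p16:
  assumes separable: "separable_space (euclidean :: 'a :: complex_banach topology)"
    and infinite_dim: "\<not> (\<exists>B :: 'a set. finite B \<and> cspan B = UNIV)"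
  shows "\<exists>T :: 'a \<Rightarrow> 'a. continuous_clinear T \<and> AP_recurrent T \<and>
    Sigma_op (map_prod T T) = {} \<and>
    (\<forall>g \<in> Sigma_op T. \<not> dense_lineable (recurrence_set T g))"
proof -
  obtain C :: "'a set" where C: "countable C" "closure C = UNIV"
    using separable by (auto simp: separable_space_def)
  then have "C \<noteq> {}" by auto
  then have range: "range (from_nat_into C) = C" using C(1) by (rule range_from_nat_into)
  obtain v :: "nat \<Rightarrow> 'a" and vs where v: "\<And>n. cfunctional (vs n)"
    "\<And>i j. vs i (v j) = (if i = j then 1 else 0)"
    "\<And>n. from_nat_into C n \<in> cspan (v ` {..n})"
    by (rule exists_biorthogonal_sequence[OF infinite_dim, of "from_nat_into C"], rule that)
  have "C \<subseteq> cspan (range v)"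
  proof -
    have "from_nat_into C n \<in> cspan (range v)" for n
      by (rule subsetD[OF complex_vector.span_mono v(3)]) auto
    then show ?thesis by (subst range[symmetric]) auto
  qed
  then have dense: "closure (cspan (range v)) = UNIV"
    using C(2) closure_mono by blast
  obtain q :: "nat \<Rightarrow> complex" where q: "\<And>z \<epsilon>. \<epsilon> > 0 \<Longrightarrow> \<exists>d. dist d z < \<epsilon> \<and> infinite {k. q k = d}"
    using exists_infinitely_repeating_dense_sequence by blast
  interpret wild_operator v vs q by unfold_locales (use v dense q in auto)
  show ?thesis
    using continuous_clinear_T AP_recurrent_T Sigma_op_sum_empty not_dense_lineable_recurrence_set
    by blast
qed

end
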